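(* For every integer $n\ge2$, \[ CP_{(2,1)}(n)=\frac{1+q^{2n-1}+q^{2n-2}}{(1-q^{2n-1})(1-q^{2n})}CP_{(2,1)}(n-1)-\frac{q^{4n-5}}{(1-q^{2n-3})(1-q^{2n-2})(1-q^{2n-1})(1-q^{2n})}CP_{(2,1)}(n-2). \]
   Context: A cylindric partition with profile $(c_1,c_2)$ is a pair of partitions $(\lambda^{(1)},\lambda^{(2)})$ (parts in weakly decreasing order, $\lambda^{(i)}_j=0$ beyond the number of parts) with $\lambda^{(1)}_j\ge\lambda^{(2)}_{j+c_2}$ and $\lambda^{(2)}_j\ge\lambda^{(1)}_{j+c_1}$ for all $j\ge1$; its size is $|\lambda^{(1)}|+|\lambda^{(2)}|$. $CP_{(2,1)}(n)$ is the generating function $\sum q^{\text{size}}$ over cylindric partitions of profile $(2,1)$ in which each partition has at most $n$ parts, with $CP_{(2,1)}(0)=1$. *)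

theory Defs
  imports "HOL-Computational_Algebra.Formal_Power_Series"
begin

text \<open>A partition is the weakly decreasing list of its positive parts.\<close>

definition is_partition :: "nat list \<Rightarrow> bool" where
  "is_partition l \<longleftrightarrow> sorted_wrt (\<ge>) l \<and> (\<forall>x\<in>set l. x > 0)"

text \<open>Parts are indexed from 1; \<open>part l j\<close> is 0 beyond the number of parts. The value at
  the index 0 is irrelevant.\<close>

definition part :: "nat list \<Rightarrow> nat \<Rightarrow> nat" where
  "part l j = (if 1 \<le> j \<and> j \<le> length l then l ! (j - 1) else 0)"

definition cylindric_partition :: "nat \<times> nat \<Rightarrow> nat list \<times> nat list \<Rightarrow> bool" where
  "cylindric_partition = (\<lambda>(c1, c2) (l1, l2).
     is_partition l1 \<and> is_partition l2 \<and>
     (\<forall>j\<ge>1. part l1 j \<ge> part l2 (j + c2)) \<and>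
     (\<forall>j\<ge>1. part l2 j \<ge> part l1 (j + c1)))"

definition cp_size :: "nat list \<times> nat list \<Rightarrow> nat" where
  "cp_size = (\<lambda>(l1, l2). sum_list l1 + sum_list l2)"

definition cylindric_partitions :: "nat \<times> nat \<Rightarrow> nat \<Rightarrow> (nat list \<times> nat list) set" where
  "cylindric_partitions c n =
     {(l1, l2). cylindric_partition c (l1, l2) \<and> length l1 \<le> n \<and> length l2 \<le> n}"

text \<open>The indeterminate \<open>q\<close> is \<^term>\<open>fps_X\<close>. Coefficients are taken in a field, so that
  quotients by series with invertible constant term are given by division.\<close>

definition CP :: "nat \<times> nat \<Rightarrow> nat \<Rightarrow> rat fps" where
  "CP c n = Abs_fps (\<lambda>m. of_nat (card {L \<in> cylindric_partitions c n. cp_size L = m}))"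

lemma finite_partitions_le: "finite {l. is_partition l \<and> sum_list l \<le> m}"
proof (rule finite_subset)
  show "{l. is_partition l \<and> sum_list l \<le> m} \<subseteq> {l. set l \<subseteq> {..m} \<and> length l \<le> m}"
  proof safe
    fix l x assume "sum_list l \<le> m" "x \<in> set l"
    then show "x \<le> m" using member_le_sum_list[of x l] by simp
  next
    fix l assume "is_partition l" "sum_list l \<le> m"
    moreover have "(\<forall>x\<in>set l. x > 0) \<Longrightarrow> length l \<le> sum_list l"
      by (induction l) auto
    ultimately show "length l \<le> m" by (simp add: is_partition_def)
  qed
qed (rule finite_lists_length_le, simp)

lemma finite_cylindric_partitions_size:
  "finite {L \<in> cylindric_partitions c n. cp_size L = m}"
proof (rule finite_subset)
  let ?P = "{l. is_partition l \<and> sum_list l \<le> m}"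
  show "{L \<in> cylindric_partitions c n. cp_size L = m} \<subseteq> ?P \<times> ?P"
    by (cases c) (auto simp: cylindric_partitions_def cylindric_partition_def cp_size_def)
qed (intro finite_cartesian_product finite_partitions_le)

lemma CP_0: "CP c 0 = 1"
proof (rule fps_ext)
  fix m
  have "{L \<in> cylindric_partitions c 0. cp_size L = m} = (if m = 0 then {([], [])} else {})"
    by (cases c) (auto simp: cylindric_partitions_def cylindric_partition_def cp_size_def
        is_partition_def part_def)
  then show "fps_nth (CP c 0) m = fps_nth 1 m"
    by (simp add: CP_def)
qed

end

theory Submission
  imports Defs
begin

text \<open>Interleave the two partitions into one sequence
  \<open>\<lambda>\<^sup>1\<^sub>1, \<lambda>\<^sup>2\<^sub>1, \<lambda>\<^sup>1\<^sub>2, \<lambda>\<^sup>2\<^sub>2, \<dots>\<close> of length \<open>2n\<close>. The conditions of profile \<open>(2,1)\<close> say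
  precisely that any two entries at distance at least 2 are weakly decreasing; adjacent entries are
  unrelated. Let \<open>F N\<close> be the generating function of such sequences of length \<open>N\<close>, by sum of
  entries. Their minimum is attained at one of the last two places. Subtracting 1 everywhere
  handles the sequences with positive minimum; otherwise either the last entry is 0, or the last
  entry \<open>z\<close> is positive and the next to last one is 0, and then \<open>z\<close> can be subtracted from all other
  entries. Hence \<open>(1 - q ^ N) F N = F (N - 1) + q ^ (N - 1) / (1 - q ^ (N - 1)) F (N - 2)\<close>, and
  eliminating the odd-indexed series gives the recurrence in steps of two.\<close>

section \<open>Generating functions of sets of lists, graded by sum\<close>

definition sum_gf :: "nat list set \<Rightarrow> rat fps" where
  "sum_gf A = Abs_fps (\<lambda>m. of_nat (card {w \<in> A. sum_list w = m}))"

lemma finite_length_sum_list: "finite {w :: nat list. length w = N \<and> sum_list w = m}"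
  by (rule finite_subset[OF _ finite_lists_length_eq[of "{..m}" N]])
     (auto simp: member_le_sum_list)

text \<open>The common length makes each class of given sum finite; without it \<open>card\<close>
  could take its default value 0 and fail to be additive.\<close>

lemma sum_gf_Un:
  assumes "\<And>w. w \<in> A \<union> B \<Longrightarrow> length w = N" and "A \<inter> B = {}"
  shows "sum_gf (A \<union> B) = sum_gf A + sum_gf B"
proof (rule fps_ext)
  fix m
  have fin: "finite {w \<in> A. sum_list w = m}" "finite {w \<in> B. sum_list w = m}"
    using assms(1) by (auto intro!: finite_subset[OF _ finite_length_sum_list[of N m]])
  have "{w \<in> A \<union> B. sum_list w = m} = {w \<in> A. sum_list w = m} \<union> {w \<in> B. sum_list w = m}"
    by auto
  then have "card {w \<in> A \<union> B. sum_list w = m}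
      = card {w \<in> A. sum_list w = m} + card {w \<in> B. sum_list w = m}"
    using fin assms(2) by (simp add: card_Un_disjoint disjoint_iff)
  then show "fps_nth (sum_gf (A \<union> B)) m = fps_nth (sum_gf A + sum_gf B) m"
    by (simp add: sum_gf_def)
qed

lemma sum_gf_image:
  assumes "inj_on h A" and "\<And>w. w \<in> A \<Longrightarrow> sum_list (h w) = sum_list w + k"
  shows "sum_gf (h ` A) = fps_X ^ k * sum_gf A"
proof (rule fps_ext)
  fix m
  have "card {w \<in> h ` A. sum_list w = m} = (if m < k then 0 else card {w \<in> A. sum_list w = m - k})"
  proof (cases "m < k")
    case True
    then have "{w \<in> h ` A. sum_list w = m} = {}"
      using assms(2) by auto
    with True show ?thesis by (metis card.empty)
  next
    case False
    then have "{w \<in> h ` A. sum_list w = m} = h ` {w \<in> A. sum_list w = m - k}"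
      using assms(2) by force
    moreover have "inj_on h {w \<in> A. sum_list w = m - k}"
      using assms(1) by (rule inj_on_subset) auto
    ultimately show ?thesis using False by (simp add: card_image)
  qed
  then show "fps_nth (sum_gf (h ` A)) m = fps_nth (fps_X ^ k * sum_gf A) m"
    by (simp add: sum_gf_def fps_X_power_mult_nth)
qed

lemma sum_list_map_Suc: "sum_list (map Suc w) = sum_list w + length w"
  by (induction w) auto

section \<open>Skip-sorted lists and their recursions\<close>

text \<open>Sequences are read from the back: the last entry of the interleaved sequence is the head.\<close>

fun skip_sorted :: "nat list \<Rightarrow> bool" where
  "skip_sorted [] \<longleftrightarrow> True"
| "skip_sorted (x # xs) \<longleftrightarrow> skip_sorted xs \<and> (\<forall>y\<in>set (tl xs). x \<le> y)"

text \<open>The recursion compares the head with everything from the third place on: these are the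
  index pairs with \<open>i = 0\<close>, and the remaining pairs lie in the tail. The index form
  serves the comparison with \<open>interleave\<close>.\<close>

lemma skip_sorted_iff_nth:
  "skip_sorted w \<longleftrightarrow> (\<forall>i j. i + 2 \<le> j \<and> j < length w \<longrightarrow> w ! i \<le> w ! j)"
proof (induction w)
  case (Cons x xs)
  have "(\<forall>y\<in>set (tl xs). x \<le> y) \<longleftrightarrow> (\<forall>j. 2 \<le> j \<and> j < length (x # xs) \<longrightarrow> x \<le> (x # xs) ! j)"
  proof safe
    fix j assume "\<forall>y\<in>set (tl xs). x \<le> y" "2 \<le> j" "j < length (x # xs)"
    moreover from this have "(x # xs) ! j = tl xs ! (j - 2)" "j - 2 < length (tl xs)"
      by (auto simp: nth_tl nth_Cons' numeral_2_eq_2 Suc_diff_Suc)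
    ultimately show "x \<le> (x # xs) ! j"
      by simp
  next
    fix y assume a: "\<forall>j. 2 \<le> j \<and> j < length (x # xs) \<longrightarrow> x \<le> (x # xs) ! j" "y \<in> set (tl xs)"
    then obtain k where "k < length (tl xs)" "y = tl xs ! k"
      by (auto simp: in_set_conv_nth)
    with a(1)[rule_format, of "k + 2"] show "x \<le> y"
      by (simp add: nth_tl)
  qed
  moreover have "(\<forall>i j. i + 2 \<le> j \<and> j < length (x # xs) \<longrightarrow> (x # xs) ! i \<le> (x # xs) ! j) \<longleftrightarrow>
      (\<forall>j. 2 \<le> j \<and> j < length (x # xs) \<longrightarrow> x \<le> (x # xs) ! j) \<and>
      (\<forall>i j. i + 2 \<le> j \<and> j < length xs \<longrightarrow> xs ! i \<le> xs ! j)" (is "?L \<longleftrightarrow> ?R1 \<and> ?R2")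
  proof (intro iffI conjI)
    assume L: ?L
    then show ?R1 by (metis add_0 nth_Cons_0)
    show ?R2
    proof (intro allI impI)
      fix i j assume "i + 2 \<le> j \<and> j < length xs"
      with L[rule_format, of "Suc i" "Suc j"] show "xs ! i \<le> xs ! j" by simp
    qed
  next
    assume R: "?R1 \<and> ?R2"
    show ?L
    proof (intro allI impI)
      fix i j assume "i + 2 \<le> j \<and> j < length (x # xs)"
      with R show "(x # xs) ! i \<le> (x # xs) ! j"
        using R[THEN conjunct1, rule_format, of j]
        by (cases i; cases j) auto
    qed
  qed
  ultimately show ?case
    using Cons.IH by auto
qed simp

lemma skip_sorted_map_Suc: "skip_sorted (map Suc w) \<longleftrightarrow> skip_sorted w"
  by (induction w) (auto simp: map_tl[symmetric])

definition skip_sorted_lists :: "nat \<Rightarrow> nat list set" where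
  "skip_sorted_lists N = {w. length w = N \<and> skip_sorted w}"

text \<open>These are the skip-sorted lists of length \<open>k + 2\<close> whose only zero is the
  second entry; \<open>k\<close> counts just the entries after it.\<close>

definition second_zero_lists :: "nat \<Rightarrow> nat list set" where
  "second_zero_lists k = {z # 0 # y |z y. z > 0 \<and> y \<in> skip_sorted_lists k \<and> (\<forall>u\<in>set y. z \<le> u)}"

lemma all_pos_eq_map_Suc:
  assumes "\<forall>u\<in>set w. u > 0"
  obtains v where "w = map Suc v"
proof
  show "w = map Suc (map (\<lambda>u. u - 1) w)"
    using assms by (induction w) auto
qed

lemma skip_sorted_lists_split:
  "skip_sorted_lists (Suc (Suc k)) =
     map Suc ` skip_sorted_lists (Suc (Suc k)) \<union>
     ((\<lambda>w. 0 # w) ` skip_sorted_lists (Suc k) \<union> second_zero_lists k)" (is "?L = ?R")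
proof (rule set_eqI)
  fix w
  show "w \<in> ?L \<longleftrightarrow> w \<in> ?R"
  proof
    assume "w \<in> ?L"
    then obtain z x y where w: "w = z # x # y" and len: "length y = k" and s: "skip_sorted w"
      by (auto simp: skip_sorted_lists_def length_Suc_conv)
    consider "z = 0" | "z > 0" "x = 0" | "z > 0" "x > 0" by auto
    then show "w \<in> ?R"
    proof cases
      case 1
      then show ?thesis using w len s by (auto simp: skip_sorted_lists_def)
    next
      case 2
      then show ?thesis using w len s
        by (auto simp: skip_sorted_lists_def second_zero_lists_def)
    next
      case 3
      \<comment> \<open>The head bounds every entry from below except the second one, so positivity
        of these two suffices.\<close>
      with s w have "\<forall>u\<in>set w. u > 0" by fastforce
      then obtain v where v: "w = map Suc v" by (rule all_pos_eq_map_Suc)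
      then have "length v = Suc (Suc k)" using w len by (metis length_Cons length_map)
      then have "v \<in> skip_sorted_lists (Suc (Suc k))"
        using v s by (simp add: skip_sorted_lists_def skip_sorted_map_Suc)
      then show ?thesis using v by blast
    qed
  next
    assume "w \<in> ?R"
    then show "w \<in> ?L"
      by (elim UnE imageE) (auto simp: skip_sorted_lists_def second_zero_lists_def skip_sorted_map_Suc)
  qed
qed

text \<open>The three pieces of the split are told apart by the zeros among the first two entries.
  Incrementing all entries adds \<open>k + 2\<close> to the sum, prepending 0 adds nothing.\<close>

lemma sum_gf_skip_sorted_lists_rec:
  "(1 - fps_X ^ (k + 2)) * sum_gf (skip_sorted_lists (k + 2)) =
     sum_gf (skip_sorted_lists (k + 1)) + sum_gf (second_zero_lists k)"
proof -
  let ?S = "skip_sorted_lists (Suc (Suc k))"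
  have len: "length w = Suc (Suc k)"
    if "w \<in> map Suc ` ?S \<union> ((\<lambda>w. 0 # w) ` skip_sorted_lists (Suc k) \<union> second_zero_lists k)" for w
    using that unfolding skip_sorted_lists_split[symmetric] by (simp add: skip_sorted_lists_def)
  have "sum_gf ?S = sum_gf (map Suc ` ?S) +
      sum_gf ((\<lambda>w. 0 # w) ` skip_sorted_lists (Suc k) \<union> second_zero_lists k)"
    by (subst skip_sorted_lists_split, rule sum_gf_Un[OF len])
       (auto simp: second_zero_lists_def Cons_eq_map_conv)
  also have "sum_gf ((\<lambda>w. 0 # w) ` skip_sorted_lists (Suc k) \<union> second_zero_lists k) =
      sum_gf ((\<lambda>w. 0 # w) ` skip_sorted_lists (Suc k)) + sum_gf (second_zero_lists k)"
    by (rule sum_gf_Un[of _ _ "Suc (Suc k)"]) (use len in \<open>auto simp: second_zero_lists_def\<close>)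
  also have "sum_gf ((\<lambda>w. 0 # w) ` skip_sorted_lists (Suc k)) = sum_gf (skip_sorted_lists (Suc k))"
    by (subst sum_gf_image[where k = 0]) auto
  also have "sum_gf (map Suc ` ?S) = fps_X ^ (k + 2) * sum_gf ?S"
    by (rule sum_gf_image)
       (auto simp: sum_list_map_Suc skip_sorted_lists_def intro: inj_on_subset[of _ UNIV])
  finally show ?thesis
    by (simp add: algebra_simps)
qed

text \<open>Incrementing all entries except the second one either makes the first entry at least 2,
  or turns it from 0 into 1.\<close>

lemma sum_gf_second_zero_lists:
  "(1 - fps_X ^ (k + 1)) * sum_gf (second_zero_lists k) =
     fps_X ^ (k + 1) * sum_gf (skip_sorted_lists k)"
proof -
  define h where "h = (\<lambda>w. Suc (hd w) # 0 # map Suc (tl (tl w)))"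
  let ?T = "second_zero_lists k" and ?Z = "(\<lambda>y. 0 # 0 # y) ` skip_sorted_lists k"
  \<comment> \<open>A fixed-point equation for \<open>?T\<close>: undoing \<open>h\<close> on a list
    with head 1 lands in \<open>?Z\<close>, and on any larger head in \<open>?T\<close> again. As
    \<open>h\<close> spares one of \<open>k + 2\<close> entries, it adds \<open>k + 1\<close> to the
    sum.\<close>
  have T_eq: "?T = h ` (?Z \<union> ?T)"
  proof (intro equalityI subsetI)
    fix w assume "w \<in> ?T"
    then obtain z y where w: "w = z # 0 # y" and z: "z > 0" and y: "y \<in> skip_sorted_lists k"
      and le: "\<forall>u\<in>set y. z \<le> u"
      by (auto simp: second_zero_lists_def)
    from z le have "\<forall>u\<in>set y. u > 0" by auto
    then obtain v where v: "y = map Suc v" by (rule all_pos_eq_map_Suc)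
    have v': "v \<in> skip_sorted_lists k"
      using y v by (simp add: skip_sorted_lists_def skip_sorted_map_Suc)
    have "w = h ((z - 1) # 0 # v)"
      using w v z by (simp add: h_def)
    moreover have "(z - 1) # 0 # v \<in> ?Z \<union> ?T"
      using v' z le v by (cases "z = 1") (auto simp: second_zero_lists_def)
    ultimately show "w \<in> h ` (?Z \<union> ?T)" by blast
  next
    fix w assume "w \<in> h ` (?Z \<union> ?T)"
    then show "w \<in> ?T"
      by (auto simp: h_def second_zero_lists_def skip_sorted_lists_def skip_sorted_map_Suc)
  qed
  have form: "\<exists>z y. w = z # 0 # y \<and> length y = k" if "w \<in> ?Z \<union> ?T" for w
    using that by (auto simp: second_zero_lists_def skip_sorted_lists_def)
  have "sum_gf ?T = sum_gf (h ` (?Z \<union> ?T))"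
    by (rule arg_cong[OF T_eq])
  also have "\<dots> = fps_X ^ (k + 1) * sum_gf (?Z \<union> ?T)"
  proof (rule sum_gf_image)
    show "inj_on h (?Z \<union> ?T)"
    proof (rule inj_onI)
      fix v w assume v: "v \<in> ?Z \<union> ?T" and w: "w \<in> ?Z \<union> ?T" and "h v = h w"
      then show "v = w"
        using form[OF v] form[OF w] by (elim exE conjE) (simp add: h_def inj_map_eq_map)
    qed
    show "sum_list (h w) = sum_list w + (k + 1)" if "w \<in> ?Z \<union> ?T" for w
      using form[OF that] by (elim exE conjE) (simp add: h_def sum_list_map_Suc)
  qed
  also have "sum_gf (?Z \<union> ?T) = sum_gf ?Z + sum_gf ?T"
  proof (rule sum_gf_Un[of _ _ "k + 2"])
    show "length w = k + 2" if "w \<in> ?Z \<union> ?T" for w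
      using form[OF that] by auto
  qed (auto simp: second_zero_lists_def)
  also have "sum_gf ?Z = sum_gf (skip_sorted_lists k)"
    by (subst sum_gf_image[where k = 0]) (auto simp: inj_on_def)
  finally show ?thesis
    by (simp add: algebra_simps)
qed

section \<open>Partitions as functions of the part index\<close>

lemma part_antimono:
  assumes "is_partition l" "1 \<le> i" "i \<le> j"
  shows "part l j \<le> part l i"
proof (cases "i = j")
  case False
  then show ?thesis using assms
    by (auto simp: part_def is_partition_def sorted_wrt_iff_nth_less)
qed simp

lemma sum_list_eq_sum_part:
  assumes "length l \<le> n"
  shows "sum_list l = (\<Sum>j=1..n. part l j)"
proof -
  have "sum_list l = (\<Sum>i<length l. l ! i)"
    by (simp add: sum_list_sum_nth atLeast0LessThan)
  also have "\<dots> = (\<Sum>i<length l. part l (Suc i))"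
    by (rule sum.cong) (auto simp: part_def)
  also have "\<dots> = (\<Sum>i<n. part l (Suc i))"
    by (rule sum.mono_neutral_left) (use assms in \<open>auto simp: part_def\<close>)
  also have "\<dots> = (\<Sum>j=1..n. part l j)"
    by (rule sum.reindex_bij_witness[of _ "\<lambda>j. j - 1" Suc]) auto
  finally show ?thesis .
qed

text \<open>As listed parts are positive, the length is the last index with nonzero part (0 if there
  is none), so the parts determine the length and then the entries.\<close>

lemma partition_eqI:
  assumes "is_partition l" "is_partition l'" "length l \<le> n" "length l' \<le> n"
    and eq: "\<And>j. 1 \<le> j \<Longrightarrow> j \<le> n \<Longrightarrow> part l j = part l' j"
  shows "l = l'"
proof -
  have pos: "part r j > 0 \<longleftrightarrow> j \<le> length r" if "is_partition r" "1 \<le> j" for r j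
    using that by (auto simp: part_def is_partition_def)
  have len: "length l = length l'"
  proof (rule antisym)
    show "length l \<le> length l'"
      using pos[of l "length l"] pos[of l' "length l"] eq[of "length l"] assms
      by (cases "length l = 0") auto
    show "length l' \<le> length l"
      using pos[of l "length l'"] pos[of l' "length l'"] eq[of "length l'"] assms
      by (cases "length l' = 0") auto
  qed
  then show ?thesis
  proof (rule nth_equalityI)
    fix i assume "i < length l"
    then show "l ! i = l' ! i"
      using eq[of "Suc i"] len assms(3) by (simp add: part_def)
  qed
qed

text \<open>Induction on \<open>n\<close> strips trailing zeros: once the last value is nonzero,
  monotonicity makes all values positive and they form the partition as they stand.\<close>

lemma exists_partition_with_parts:
  fixes f :: "nat \<Rightarrow> nat"
  assumes "\<And>i j. 1 \<le> i \<Longrightarrow> i \<le> j \<Longrightarrow> j \<le> n \<Longrightarrow> f j \<le> f i"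
  shows "\<exists>l. is_partition l \<and> length l \<le> n \<and> (\<forall>j. 1 \<le> j \<and> j \<le> n \<longrightarrow> part l j = f j)"
  using assms
proof (induction n)
  case 0
  show ?case by (rule exI[of _ "[]"]) (simp add: is_partition_def)
next
  case (Suc n)
  show ?case
  proof (cases "f (Suc n) = 0")
    case True
    obtain l where l: "is_partition l" "length l \<le> n"
      "\<forall>j. 1 \<le> j \<and> j \<le> n \<longrightarrow> part l j = f j"
      using Suc by (metis le_Suc_eq)
    then have "part l (Suc n) = f (Suc n)"
      using True by (simp add: part_def)
    with l show ?thesis
      by (metis le_Suc_eq)
  next
    case False
    have pos: "f j > 0" if "1 \<le> j" "j \<le> Suc n" for j
      using Suc.prems[of j "Suc n"] that False by simp
    show ?thesis
    proof (intro exI[of _ "map f [1..<n + 2]"] conjI allI impI)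
      show "is_partition (map f [1..<n + 2])"
        unfolding is_partition_def sorted_wrt_iff_nth_less
        using Suc.prems pos by (auto simp del: upt_Suc)
      fix j assume "1 \<le> j \<and> j \<le> Suc n"
      then show "part (map f [1..<n + 2]) j = f j"
        by (auto simp: part_def simp del: upt_Suc)
    qed simp
  qed
qed

section \<open>Cylindric partitions as skip-sorted lists\<close>

text \<open>Both partitions are padded with zeros to \<open>n\<close> parts, and the list starts
  with the last parts. Since \<open>i div 2 < n\<close>, the meaningless part index 0 never
  occurs.\<close>

definition interleave :: "nat \<Rightarrow> nat list \<times> nat list \<Rightarrow> nat list" where
  "interleave n = (\<lambda>(l1, l2).
     map (\<lambda>i. part (if even i then l2 else l1) (n - i div 2)) [0..<2 * n])"

lemma length_interleave [simp]: "length (interleave n L) = 2 * n"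
  by (simp add: interleave_def split: prod.splits)

lemma nth_interleave:
  assumes "s < n"
  shows "interleave n (l1, l2) ! (2 * s) = part l2 (n - s)"
    and "interleave n (l1, l2) ! Suc (2 * s) = part l1 (n - s)"
  using assms by (auto simp: interleave_def)

lemma sum_list_interleave:
  assumes "length l1 \<le> n" "length l2 \<le> n"
  shows "sum_list (interleave n (l1, l2)) = cp_size (l1, l2)"
proof -
  \<comment> \<open>The summation bound \<open>m\<close> is separated from the \<open>n\<close> in
    the summand so that induction can peel off two positions at a time.\<close>
  have "(\<Sum>i<2 * m. part (if even i then l2 else l1) (n - i div 2)) =
      (\<Sum>s<m. part l2 (n - s)) + (\<Sum>s<m. part l1 (n - s))" for m
    by (induction m) auto
  then have "sum_list (interleave n (l1, l2)) =
      (\<Sum>s<n. part l2 (n - s)) + (\<Sum>s<n. part l1 (n - s))"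
    by (simp add: interleave_def interv_sum_list_conv_sum_set_nat atLeast0LessThan)
  moreover have "(\<Sum>s<n. part l (n - s)) = (\<Sum>j=1..n. part l j)" for l
    by (rule sum.reindex_bij_witness[of _ "\<lambda>j. n - j" "\<lambda>s. n - s"]) auto
  ultimately show ?thesis
    using assms by (simp add: cp_size_def sum_list_eq_sum_part[of _ n])
qed

text \<open>The parts with index \<open>j\<close> stand at positions \<open>2 * (n - j)\<close> and
  \<open>2 * (n - j) + 1\<close>, and \<open>partition_eqI\<close> recovers the partitions from
  them. Only partition properties enter, so the profile is arbitrary.\<close>

lemma inj_on_interleave: "inj_on (interleave n) (cylindric_partitions c n)"
proof (rule inj_onI)
  fix L M assume "L \<in> cylindric_partitions c n" "M \<in> cylindric_partitions c n"
    and eq: "interleave n L = interleave n M"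
  then obtain l1 l2 m1 m2 where LM: "L = (l1, l2)" "M = (m1, m2)"
    and l: "is_partition l1" "is_partition l2" "length l1 \<le> n" "length l2 \<le> n"
    and m: "is_partition m1" "is_partition m2" "length m1 \<le> n" "length m2 \<le> n"
    by (cases c) (auto simp: cylindric_partitions_def cylindric_partition_def)
  have "part l1 j = part m1 j \<and> part l2 j = part m2 j" if "1 \<le> j" "j \<le> n" for j
    using nth_interleave[of "n - j" n l1 l2] nth_interleave[of "n - j" n m1 m2] eq that LM by simp
  then have "l1 = m1" "l2 = m2"
    using l m by (auto intro: partition_eqI[where n = n])
  with LM show "L = M" by simp
qed

text \<open>Positions of equal parity belong to one partition. For opposite parity, distance at
  least 2 means at least 3, which is where the cylindric conditions start.\<close>

lemma skip_sorted_interleave: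
  assumes "cylindric_partition (2, 1) (l1, l2)"
  shows "skip_sorted (interleave n (l1, l2))"
  unfolding skip_sorted_iff_nth
proof (intro allI impI)
  fix i j assume ij: "i + 2 \<le> j \<and> j < length (interleave n (l1, l2))"
  have p: "is_partition l1" "is_partition l2"
    and c: "\<And>j. 1 \<le> j \<Longrightarrow> part l2 (j + 1) \<le> part l1 j" "\<And>j. 1 \<le> j \<Longrightarrow> part l1 (j + 2) \<le> part l2 j"
    using assms by (auto simp: cylindric_partition_def)
  define s t where "s = i div 2" and "t = j div 2"
  have st: "s < n" "t < n" using ij by (auto simp: s_def t_def)
  have ic: "i = 2 * s \<or> i = Suc (2 * s)" and jc: "j = 2 * t \<or> j = Suc (2 * t)"
    by (auto simp: s_def t_def)
  note nth = nth_interleave[OF st(1)] nth_interleave[OF st(2)]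
  from ic jc consider (ee) "i = 2 * s" "j = 2 * t" | (eo) "i = 2 * s" "j = Suc (2 * t)"
    | (oe) "i = Suc (2 * s)" "j = 2 * t" | (oo) "i = Suc (2 * s)" "j = Suc (2 * t)"
    by blast
  then show "interleave n (l1, l2) ! i \<le> interleave n (l1, l2) ! j"
  proof cases
    case ee
    then show ?thesis using ij st p by (auto simp: nth intro!: part_antimono)
  next
    \<comment> \<open>Here \<open>i + 2 \<le> j\<close> gives \<open>s + 1 \<le> t\<close>, and in
      case \<open>oe\<close> it gives \<open>s + 2 \<le> t\<close>: exactly the two shifts of the
      profile.\<close>
    case eo
    then have "part l2 (n - s) \<le> part l2 (n - t + 1)"
      using ij st p by (intro part_antimono) auto
    also have "\<dots> \<le> part l1 (n - t)" using c(1) st by simp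
    finally show ?thesis using eo by (simp add: nth)
  next
    case oe
    then have "part l1 (n - s) \<le> part l1 (n - t + 2)"
      using ij st p by (intro part_antimono) auto
    also have "\<dots> \<le> part l2 (n - t)" using c(2)[of "n - t"] st by simp
    finally show ?thesis using oe by (simp add: nth)
  next
    case oo
    then show ?thesis using ij st p by (auto simp: nth intro!: part_antimono)
  qed
qed

text \<open>For surjectivity, the two parity classes of a skip-sorted list are monotone and hence
  come from partitions; comparing entries at distance 3 yields the cylindric conditions.\<close>

lemma interleave_image: "interleave n ` cylindric_partitions (2, 1) n = skip_sorted_lists (2 * n)"
proof (intro equalityI subsetI)
  fix w assume "w \<in> interleave n ` cylindric_partitions (2, 1) n"
  then show "w \<in> skip_sorted_lists (2 * n)"
    by (auto simp: skip_sorted_lists_def cylindric_partitions_def skip_sorted_interleave)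
next
  fix w assume "w \<in> skip_sorted_lists (2 * n)"
  then have len: "length w = 2 * n"
    and le: "\<And>i j. i + 2 \<le> j \<Longrightarrow> j < 2 * n \<Longrightarrow> w ! i \<le> w ! j"
    by (auto simp: skip_sorted_lists_def skip_sorted_iff_nth)
  have mono: "w ! (2 * (n - j)) \<le> w ! (2 * (n - i))"
    "w ! Suc (2 * (n - j)) \<le> w ! Suc (2 * (n - i))"
    if "1 \<le> i" "i \<le> j" "j \<le> n" for i j
    using that by (cases "i = j"; auto intro!: le)+
  obtain l1 where l1: "is_partition l1" "length l1 \<le> n"
    and part1: "\<And>j. 1 \<le> j \<Longrightarrow> j \<le> n \<Longrightarrow> part l1 j = w ! Suc (2 * (n - j))"
    using exists_partition_with_parts[of n "\<lambda>j. w ! Suc (2 * (n - j))"] mono(2) by blast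
  obtain l2 where l2: "is_partition l2" "length l2 \<le> n"
    and part2: "\<And>j. 1 \<le> j \<Longrightarrow> j \<le> n \<Longrightarrow> part l2 j = w ! (2 * (n - j))"
    using exists_partition_with_parts[of n "\<lambda>j. w ! (2 * (n - j))"] mono(1) by blast
  \<comment> \<open>Within range both parts are entries of \<open>w\<close> at distance 3; past
    \<open>n\<close> the left part is 0. The second condition goes the same way.\<close>
  have "part l2 (j + 1) \<le> part l1 j" if "1 \<le> j" for j
  proof (cases "j + 1 \<le> n")
    case True
    then show ?thesis using that by (auto simp: part1 part2 intro!: le)
  next
    case False
    then show ?thesis using l2(2) by (simp add: part_def)
  qed
  moreover have "part l1 (j + 2) \<le> part l2 j" if "1 \<le> j" for j
  proof (cases "j + 2 \<le> n")
    case True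
    then show ?thesis using that by (subst part1 part2; (simp; fail)?)+ (auto intro!: le)
  next
    case False
    then show ?thesis using l1(2) by (simp add: part_def)
  qed
  ultimately have "(l1, l2) \<in> cylindric_partitions (2, 1) n"
    using l1 l2 by (simp add: cylindric_partitions_def cylindric_partition_def)
  moreover have "w = interleave n (l1, l2)"
  proof (rule nth_equalityI)
    fix i assume "i < length w"
    then have s: "i div 2 < n" using len by simp
    show "w ! i = interleave n (l1, l2) ! i"
    proof (cases "even i")
      case True
      then have "i = 2 * (i div 2)" by simp
      then show ?thesis
        using nth_interleave(1)[OF s, of l1 l2] part2[of "n - i div 2"] s by simp
    next
      case False
      then have "i = Suc (2 * (i div 2))" by simp
      then show ?thesis
        using nth_interleave(2)[OF s, of l1 l2] part1[of "n - i div 2"] s by simp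
    qed
  qed (simp add: len)
  ultimately show "w \<in> interleave n ` cylindric_partitions (2, 1) n" by blast
qed

lemma CP_2_1_eq_sum_gf: "CP (2, 1) n = sum_gf (skip_sorted_lists (2 * n))"
proof (rule fps_ext)
  fix m
  let ?A = "{L \<in> cylindric_partitions (2, 1) n. cp_size L = m}"
  have size: "sum_list (interleave n L) = cp_size L" if "L \<in> cylindric_partitions (2, 1) n" for L
    using that by (auto simp: cylindric_partitions_def sum_list_interleave)
  have "{w \<in> skip_sorted_lists (2 * n). sum_list w = m} = interleave n ` ?A"
    unfolding interleave_image[symmetric] using size by auto
  moreover have "inj_on (interleave n) ?A"
    using inj_on_interleave by (rule inj_on_subset) auto
  ultimately show "fps_nth (CP (2, 1) n) m = fps_nth (sum_gf (skip_sorted_lists (2 * n))) m"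
    by (simp add: CP_def sum_gf_def card_image)
qed

section \<open>Elimination of the odd-indexed series\<close>

theorem theorem4p1:
  fixes n :: nat
  assumes "n \<ge> 2"
  shows "CP (2, 1) n =
      (1 + fps_X ^ (2 * n - 1) + fps_X ^ (2 * n - 2))
        / ((1 - fps_X ^ (2 * n - 1)) * (1 - fps_X ^ (2 * n))) * CP (2, 1) (n - 1)
    - fps_X ^ (4 * n - 5)
        / ((1 - fps_X ^ (2 * n - 3)) * (1 - fps_X ^ (2 * n - 2))
           * (1 - fps_X ^ (2 * n - 1)) * (1 - fps_X ^ (2 * n))) * CP (2, 1) (n - 2)"
proof -
  \<comment> \<open>With \<open>n \<ge> 2\<close> no subtraction is truncated, and every index
    becomes \<open>k\<close> plus a constant.\<close>
  define k where "k = 2 * n - 4"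
  have idx: "2 * n = k + 4" "2 * n - 1 = k + 3" "2 * n - 2 = k + 2" "2 * n - 3 = k + 1"
    "2 * (n - 1) = k + 2" "2 * (n - 2) = k" "4 * n - 5 = (k + 1) + (k + 2)"
    using assms by (auto simp: k_def)
  define F where "F = (\<lambda>i. sum_gf (skip_sorted_lists (k + i)))"
  \<comment> \<open>The lists counted by \<open>T i\<close> have length \<open>k + i + 2\<close>, so
    \<open>T i\<close> is a part of \<open>F (i + 2)\<close>.\<close>
  define T where "T = (\<lambda>i. sum_gf (second_zero_lists (k + i)))"
  define x :: "nat \<Rightarrow> rat fps" where "x = (\<lambda>i. fps_X ^ (k + i))"
  have rec: "(1 - x (i + 2)) * F (i + 2) = F (i + 1) + T i"
    "(1 - x (i + 1)) * T i = x (i + 1) * F i" for i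
    using sum_gf_skip_sorted_lists_rec[of "k + i"] sum_gf_second_zero_lists[of "k + i"]
    by (simp_all add: F_def T_def x_def add.assoc)
  \<comment> \<open>The case \<open>i = 0\<close> must be excluded: for \<open>n = 2\<close> we have
    \<open>k = 0\<close> and \<open>1 - x 0 = 0\<close>.\<close>
  have unit: "fps_nth (1 - x i) 0 \<noteq> 0" if "i > 0" for i
    using that by (simp add: x_def)
  have inv: "inverse (1 - x i) * (1 - x i) = 1" if "i > 0" for i
    using unit[OF that] by (rule inverse_mult_eq_1)
  \<comment> \<open>The right-hand side of the recurrence multiplied by all four denominators;
    \<open>x 1 * x 2\<close> is the power with exponent \<open>4 * n - 5\<close>.\<close>
  define N where "N = (1 + x 3 + x 2) * (1 - x 1) * (1 - x 2) * F 2 - x 1 * x 2 * F 0"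
  have N_eq: "N = (1 - x 1) * (1 - x 2) * (1 - x 3) * (1 - x 4) * F 4"
  proof -
    have r: "(1 - x 4) * F 4 = F 3 + T 2" "(1 - x 3) * T 2 = x 3 * F 2"
      "(1 - x 3) * F 3 = F 2 + T 1" "(1 - x 2) * T 1 = x 2 * F 1"
      "(1 - x 2) * F 2 = F 1 + T 0" "(1 - x 1) * T 0 = x 1 * F 0"
      using rec(1)[of 2] rec(2)[of 2] rec(1)[of 1] rec(2)[of 1] rec(1)[of 0] rec(2)[of 0]
      by (simp_all add: numeral_eq_Suc)
    have "(1 - x 1) * (1 - x 2) * (1 - x 3) * (1 - x 4) * F 4 =
        (1 - x 1) * (1 - x 2) * ((1 - x 3) * F 3 + (1 - x 3) * T 2)"
      by (simp add: mult.assoc r(1) flip: distrib_left)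
    also have "\<dots> = (1 - x 1) * (1 - x 2) * (1 + x 3) * F 2 + (1 - x 1) * ((1 - x 2) * T 1)"
      by (simp only: r(2,3)) (simp add: algebra_simps)
    \<comment> \<open>\<open>(1 - x 2) * T 1\<close> equals \<open>x 2 * F 1\<close>, and the
      relation for \<open>F 2\<close> read backwards replaces \<open>F 1\<close> by
      \<open>(1 - x 2) * F 2 - T 0\<close>. This removes the last odd-indexed series.\<close>
    also have "\<dots> = (1 - x 1) * (1 - x 2) * (1 + x 3) * F 2
        + x 2 * ((1 - x 1) * ((1 - x 2) * F 2) - (1 - x 1) * T 0)"
      by (simp only: r(4,5)) (simp add: algebra_simps)
    also have "\<dots> = N"
      by (simp only: r(6)) (simp add: N_def algebra_simps)
    finally show ?thesis by (rule sym)
  qed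
  have "inverse (1 - x 4) * (1 - x 4) * (inverse (1 - x 3) * (1 - x 3)) *
      (inverse (1 - x 2) * (1 - x 2)) * (inverse (1 - x 1) * (1 - x 1)) * F 4 =
      inverse (1 - x 1) * inverse (1 - x 2) * inverse (1 - x 3) * inverse (1 - x 4) * N"
    unfolding N_eq by (simp only: mult_ac)
  then have "F 4 = inverse (1 - x 1) * inverse (1 - x 2) * inverse (1 - x 3) * inverse (1 - x 4) * N"
    by (simp add: inv)
  also have "\<dots> = (1 + x 3 + x 2) * (inverse (1 - x 3) * inverse (1 - x 4)) * F 2
      - (x 1 * x 2) * (inverse (1 - x 1) * inverse (1 - x 2) * inverse (1 - x 3) * inverse (1 - x 4)) * F 0"
  proof -
    \<comment> \<open>The inverses of \<open>1 - x 1\<close> and \<open>1 - x 2\<close> cancel in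
      the \<open>F 2\<close> term only, which explains the unequal denominators.\<close>
    have "inverse (1 - x 1) * inverse (1 - x 2) * inverse (1 - x 3) * inverse (1 - x 4) * N =
      (inverse (1 - x 1) * (1 - x 1)) * (inverse (1 - x 2) * (1 - x 2)) *
        ((1 + x 3 + x 2) * (inverse (1 - x 3) * inverse (1 - x 4)) * F 2)
      - (x 1 * x 2) * (inverse (1 - x 1) * inverse (1 - x 2) * inverse (1 - x 3) * inverse (1 - x 4)) * F 0"
      unfolding N_def right_diff_distrib[of _ "_ * F 2"] by (simp only: mult_ac)
    then show ?thesis by (simp add: inv)
  qed
  also have "\<dots> = (1 + x 3 + x 2) / ((1 - x 3) * (1 - x 4)) * F 2
      - (x 1 * x 2) / ((1 - x 1) * (1 - x 2) * (1 - x 3) * (1 - x 4)) * F 0"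
    using unit by (simp add: fps_divide_unit fps_inverse_mult mult.assoc)
  finally show ?thesis
    unfolding CP_2_1_eq_sum_gf idx(2-7) unfolding idx(1) F_def x_def
    by (simp only: add_0_right power_add[of _ "k + 1" "k + 2"])
qed

end
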